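(* There is a unique real number $B_0 < \log 3$ such that $\langle \mathcal{E}(x,B_0)\rangle_x = 0$. Moreover, this number $B_0$ satisfies $1.0825 \le B_0 \le 1.0850$.
   Context: Here $\log$ is the natural logarithm and $\pi(x)$ denotes the number of primes $\le x$. For a real number $B$ and a given $x$ (with $\log x \neq B$), define $$\mathcal{E}(x,B) = \frac{x}{\log x - B} - \pi(x) - 1.$$ Let $\langle \mathcal{E}(x,B)\rangle_x$ denote the average (arithmetic mean) of $\mathcal{E}(x,B)$ over all primes $x$ with $3 \le x \le 10^6$, i.e. $$\langle \mathcal{E}(x,B)\rangle_x = \frac{1}{N}\sum_{\substack{3\le p\le 10^6\\ p \text{ prime}}} \mathcal{E}(p,B),$$ where $N$ is the number of primes $p$ with $3\le p\le 10^6$. For $B<\log 3$ all denominators $\log p - B$ are positive. *)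

theory Defs
  imports Complex_Main "HOL-Computational_Algebra.Primes"
begin

definition prime_pi :: "real \<Rightarrow> nat" where
  "prime_pi x = card {p::nat. prime p \<and> real p \<le> x}"

(* Only meaningful for ln x \<noteq> B; at ln x = B the quotient is 0 by the convention x / 0 = 0. *)
definition E_err :: "real \<Rightarrow> real \<Rightarrow> real" where
  "E_err x B = x / (ln x - B) - real (prime_pi x) - 1"

definition sample_primes :: "nat set" where
  "sample_primes = {p. prime p \<and> 3 \<le> p \<and> p \<le> 10 ^ 6}"

definition mean_E :: "real \<Rightarrow> real" where
  "mean_E B = (1 / real (card sample_primes)) * (\<Sum>p\<in>sample_primes. E_err (real p) B)"

end

theory Submission
  imports Defs "HOL-Library.Product_Plus" "HOL-Analysis.Harmonic_Numbers"
begin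

text \<open>
  Write \<open>F(B)\<close> for the sum of \<open>p / (ln p - B)\<close> over the primes \<open>3 \<le> p \<le> 10 ^ 6\<close>. The remaining
  part of the sum of the errors does not depend on \<open>B\<close>: the prime counting function takes the
  values \<open>2, 3, \<dots>, 78498\<close> on these primes, so the mean vanishes iff \<open>F(B) = 3081085747\<close>
  (\<open>mean_E_eq_0_iff\<close>). Below \<open>ln 3\<close> every summand is continuous and strictly increasing in \<open>B\<close>.
  Hence there is at most one root, and the theorem follows from the intermediate value theorem
  once \<open>F(1.0825) < 3081085747 < F(1.0850)\<close> is known.

  The difficulty is to establish these two inequalities. The first one is tight: \<open>F(1.0825)\<close> falls
  short of the constant by about 75000, a relative distance of \<open>2.4 * 10 ^ - 5\<close>. This calls
  for the exact number of primes, but only up to a few points. For \<open>ln x - B \<ge> 2\<close> the function \<open>x / (ln x - B)\<close> is concave. In an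
  interval \<open>(a, b]\<close> it lies below each of its tangents (\<open>log_quotient_le_tangent\<close>) and above its
  chord (\<open>log_quotient_ge_chord\<close>). The sum of an affine function over the primes in \<open>(a, b]\<close> is
  determined by their number and their sum. With 38 blocks the tangents lose less than 60000 in
  total, which decides the first inequality, and half as many chords decide the second.

  It remains to find the number and the sum of the primes up to each of the 39 block ends. This is
  done by Legendre's recursion (\<open>rough_minus_rough_Suc\<close>, \<open>sifted_eq_step\<close>): if \<open>S(v, d)\<close> is the sum
  of a completely multiplicative \<open>f\<close> over the numbers up to \<open>v\<close> that survive the sieve with
  the primes below \<open>d\<close>, then sieving by a further prime \<open>p\<close> with \<open>p\<^sup>2 \<le> v\<close> subtracts
  \<open>f(p) (S(v / p, p) - S(p - 1, p))\<close>. With a table of the primes below 2214 and a closed form for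
  the sieve by 2, 3 and 5, only a few thousand terms arise for \<open>v = 10 ^ 6\<close>, few enough for
  evaluation by rewriting.
\<close>

section \<open>A sieve for the number and the sum of the primes up to a bound\<close>

text \<open>
  All that the analytic part needs to know about the primes in an interval is their number and
  their sum. Both are sums of completely multiplicative functions, so one sieve computes the
  pair; \<open>scale k\<close> is its behaviour under multiplication of all elements by \<open>k\<close>.
\<close>

definition stats :: "nat set \<Rightarrow> int \<times> int" where
  "stats S = (int (card S), \<Sum>m\<in>S. int m)"

definition scale :: "int \<Rightarrow> int \<times> int \<Rightarrow> int \<times> int" where
  "scale k x = (fst x, k * snd x)"

lemma stats_empty [simp]: "stats {} = 0"
  by (simp add: stats_def zero_prod_def)

lemma stats_Un_disjoint:
  assumes "finite S" "finite T" "S \<inter> T = {}"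
  shows "stats (S \<union> T) = stats S + stats T"
  using assms by (simp add: stats_def card_Un_disjoint sum.union_disjoint)

lemma stats_Diff:
  assumes "finite S" "T \<subseteq> S"
  shows "stats (S - T) = stats S - stats T"
proof -
  have "stats (S - T \<union> T) = stats (S - T) + stats T"
    using assms finite_subset[OF assms(2,1)] by (intro stats_Un_disjoint) auto
  moreover have "S - T \<union> T = S"
    using assms by auto
  ultimately show ?thesis
    by simp
qed

lemma stats_times_image:
  assumes "k > 0"
  shows "stats ((*) k ` S) = scale (int k) (stats S)"
proof -
  have "inj_on ((*) k) S"
    using assms by (auto simp: inj_on_def)
  then show ?thesis
    by (simp add: stats_def scale_def card_image sum.reindex sum_distrib_left)
qed

text \<open>
  What remains of the numbers from 2 to \<open>v\<close> after the sieve of Eratosthenes has been run with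
  the primes below \<open>d\<close>; the sieving primes themselves stay in the set.
\<close>

definition rough :: "nat \<Rightarrow> nat \<Rightarrow> nat set" where
  "rough d v = {m. 2 \<le> m \<and> m \<le> v \<and> (\<forall>q. prime q \<and> q < d \<and> q dvd m \<longrightarrow> q = m)}"

definition primes_upto :: "nat \<Rightarrow> nat set" where
  "primes_upto v = {q. prime q \<and> q \<le> v}"

definition primes_below :: "nat \<Rightarrow> nat set" where
  "primes_below v = {q. prime q \<and> q < v}"

lemma finite_rough [simp]: "finite (rough d v)"
  by (rule finite_subset[of _ "{..v}"]) (auto simp: rough_def)

lemma finite_primes_upto [simp]: "finite (primes_upto v)"
  by (rule finite_subset[of _ "{..v}"]) (auto simp: primes_upto_def)

lemma finite_primes_below [simp]: "finite (primes_below v)"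
  by (rule finite_subset[of _ "{..v}"]) (auto simp: primes_below_def)

lemma rough_antimono: "d \<le> e \<Longrightarrow> rough e v \<subseteq> rough d v"
  by (auto simp: rough_def)

lemma primes_upto_subset_rough: "primes_upto v \<subseteq> rough d v"
  by (auto simp: rough_def primes_upto_def prime_ge_2_nat primes_dvd_imp_eq)

text \<open>
  A composite number has a prime factor whose square is at most the number, so sieving with the
  primes below \<open>d\<close> removes every composite number less than \<open>d * d\<close>.
\<close>

lemma rough_eq_primes_upto:
  assumes "v < d * d"
  shows "rough d v = primes_upto v"
proof
  show "rough d v \<subseteq> primes_upto v"
  proof
    fix m assume m: "m \<in> rough d v"
    have "prime m"
    proof (rule ccontr)
      assume "\<not> prime m"
      moreover have "1 < m"
        using m by (auto simp: rough_def)
      ultimately obtain a b where "m = a * b" "1 < a" "1 < b"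
        using prime_nat_iff[of m]
        by (metis One_nat_def Suc_lessI dvd_def dvd_pos_nat less_trans nat_dvd_1_iff_1
            dvd_triv_right less_numeral_extra(1) mult.right_neutral)
      then obtain a b where ab: "m = a * b" "1 < a" "1 < b" "a \<le> b"
        by (metis mult.commute nat_le_linear)
      obtain q where q: "prime q" "q dvd a"
        using ab(2) prime_factor_nat[of a] by auto
      have "q \<le> a"
        using q ab(2) by (auto intro: dvd_imp_le)
      then have "q * q \<le> m" "q < m"
        using ab by (auto intro: mult_le_mono order.strict_trans1)
      then have "q * q < d * d"
        using assms m by (auto simp: rough_def)
      then have "q < d"
        by (meson mult_le_mono not_le)
      then show False
        using m q ab(1) \<open>q < m\<close> by (auto simp: rough_def)
    qed
    then show "m \<in> primes_upto v"
      using m by (auto simp: rough_def primes_upto_def)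
  qed
qed (rule primes_upto_subset_rough)

text \<open>
  Legendre's recursion. The prime \<open>p\<close> strikes out the proper multiples \<open>p * j\<close> that are still
  present, and \<open>p * j\<close> is still present exactly if \<open>j\<close> has no prime factor below \<open>p\<close>. These \<open>j\<close>
  are the members of \<open>rough p (v div p)\<close> other than the primes below \<open>p\<close>.
\<close>

lemma rough_minus_rough_Suc:
  assumes p: "prime p"
  shows "rough p v - rough (Suc p) v = (*) p ` (rough p (v div p) - primes_below p)"
proof (intro equalityI subsetI)
  fix m assume m: "m \<in> rough p v - rough (Suc p) v"
  then obtain q where q: "prime q" "q < Suc p" "q dvd m" "q \<noteq> m"
    by (auto simp: rough_def)
  with m have "q = p"
    by (auto simp: rough_def less_Suc_eq)
  then obtain j where j: "m = p * j"
    using q by auto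
  have "j \<noteq> 0" "j \<noteq> 1"
    using m q j \<open>q = p\<close> by (auto simp: rough_def)
  then have "2 \<le> j" by simp
  have no: "\<not> q dvd j" if "prime q" "q < p" for q
  proof
    assume "q dvd j"
    then have "q = m"
      using m that j by (auto simp: rough_def)
    then show False
      using that j \<open>2 \<le> j\<close> by simp
  qed
  have "j \<le> v div p"
    using m j p by (auto simp: rough_def less_eq_div_iff_mult_less_eq prime_gt_0_nat mult.commute)
  then have "j \<in> rough p (v div p) - primes_below p"
    using no[of j] no \<open>2 \<le> j\<close> by (auto simp: rough_def primes_below_def)
  then show "m \<in> (*) p ` (rough p (v div p) - primes_below p)"
    using j by auto
next
  fix m assume "m \<in> (*) p ` (rough p (v div p) - primes_below p)"
  then obtain j where j: "m = p * j" "j \<in> rough p (v div p)" "j \<notin> primes_below p"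
    by auto
  have "p \<ge> 2"
    using p by (rule prime_ge_2_nat)
  have "2 \<le> j" "j \<le> v div p"
    using j by (auto simp: rough_def)
  then have "m \<le> v"
    using j \<open>p \<ge> 2\<close> by (auto simp: less_eq_div_iff_mult_less_eq mult.commute)
  moreover have "2 \<le> m" "p \<noteq> m"
    using j \<open>2 \<le> j\<close> \<open>p \<ge> 2\<close> by (auto intro: order_trans[of 2 p])
  moreover have "q = m" if "prime q" "q < p" "q dvd m" for q
  proof -
    have "q dvd j"
      using that p j(1) by (metis prime_dvd_mult_iff primes_dvd_imp_eq less_irrefl)
    then have "q = j"
      using that j by (auto simp: rough_def)
    then show ?thesis
      using j that by (auto simp: primes_below_def)
  qed
  ultimately show "m \<in> rough p v - rough (Suc p) v"
    using p j(1) by (auto simp: rough_def)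
qed

definition next_prime :: "nat \<Rightarrow> nat" where
  "next_prime x = (LEAST q. prime q \<and> x < q)"

lemma next_prime: "prime (next_prime x)" "x < next_prime x"
  using LeastI_ex[of "\<lambda>q. prime q \<and> x < q"] bigger_prime[of x]
  by (auto simp: next_prime_def)

lemma next_prime_le: "prime q \<Longrightarrow> x < q \<Longrightarrow> next_prime x \<le> q"
  by (auto simp: next_prime_def intro: Least_le)

lemma rough_next_prime: "rough (next_prime x) v = rough (Suc x) v"
proof -
  have "q < next_prime x \<longleftrightarrow> q < Suc x" if "prime q" for q
    using next_prime(2)[of x] next_prime_le[OF that, of x] by linarith
  then show ?thesis
    by (auto simp: rough_def)
qed

lemma primes_upto_eq_below_next_prime: "primes_upto v = primes_below (next_prime v)"
proof -
  have "q \<le> v \<longleftrightarrow> q < next_prime v" if "prime q" for q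
    using next_prime(2)[of v] next_prime_le[OF that, of v] by linarith
  then show ?thesis
    by (auto simp: primes_upto_def primes_below_def)
qed

text \<open>
  \<open>sifted v d x\<close> accounts for the numbers up to \<open>v\<close> that are removed by the primes \<open>p\<close> with
  \<open>x < p < d\<close>. Splitting off the smallest such prime gives a loop whose body is \<open>sift_step\<close>.
  The loop is indexed by an arbitrary \<open>x\<close> rather than by a prime in order that its recursion
  equation needs no primality hypothesis, which would have to be discharged at every step of the
  evaluation.
\<close>

definition sifted :: "nat \<Rightarrow> nat \<Rightarrow> nat \<Rightarrow> int \<times> int" where
  "sifted v d x = stats (rough (Suc x) v - rough d v)"

definition sift_step :: "nat \<Rightarrow> nat \<Rightarrow> nat \<Rightarrow> int \<times> int" where
  "sift_step v d p =
     (if p < d \<and> p * p \<le> v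
      then scale (int p) (stats (rough p (v div p)) - stats (primes_below p)) + sifted v d p
      else (0, 0))"

lemma sifted_eq_step: "sifted v d x = sift_step v d (next_prime x)"
proof -
  define p where "p = next_prime x"
  have p: "prime p"
    by (simp add: p_def next_prime)
  have sifted: "sifted v d x = stats (rough p v - rough d v)"
    by (simp add: sifted_def p_def rough_next_prime)
  show ?thesis
  proof (cases "p < d \<and> p * p \<le> v")
    case True
    \<comment> \<open>the primes below p all lie in rough p (v div p), so their statistics may be subtracted\<close>
    have "p \<le> v div p"
      using True p by (simp add: less_eq_div_iff_mult_less_eq prime_gt_0_nat)
    then have "primes_below p \<subseteq> rough p (v div p)"
      using primes_upto_subset_rough[of "v div p" p]
      by (auto simp: primes_below_def primes_upto_def)
    then have "stats (rough p v - rough (Suc p) v) =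
        scale (int p) (stats (rough p (v div p)) - stats (primes_below p))"
      using p by (simp add: rough_minus_rough_Suc stats_times_image prime_gt_0_nat stats_Diff)
    moreover have "rough p v - rough d v =
        (rough p v - rough (Suc p) v) \<union> (rough (Suc p) v - rough d v)"
      using True rough_antimono[of "Suc p" d v] rough_antimono[of p "Suc p" v] by auto
    then have "stats (rough p v - rough d v) =
        stats (rough p v - rough (Suc p) v) + stats (rough (Suc p) v - rough d v)"
      by (simp only:) (subst stats_Un_disjoint; auto)
    ultimately show ?thesis
      using True unfolding sifted p_def[symmetric] by (simp add: sift_step_def sifted_def)
  next
    case False
    have "rough p v \<subseteq> rough d v"
    proof (cases "p < d")
      case True
      then show ?thesis
        using False by (simp add: rough_eq_primes_upto primes_upto_subset_rough)
    qed (simp add: rough_antimono)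
    then have "rough p v - rough d v = {}"
      by blast
    then show ?thesis
      using False unfolding sifted p_def[symmetric] by (simp only: sift_step_def if_False stats_empty zero_prod_def)
  qed
qed

text \<open>
  The primes 2, 3 and 5 account for most of the branching of the recursion. Sieving by them is
  done in closed form, through the periodicity of coprimality to 30.
\<close>

definition units30 :: "nat \<Rightarrow> int \<times> int" where
  "units30 v = stats {m. 1 \<le> m \<and> m \<le> v \<and> coprime m 30}"

lemma units30_0 [simp]: "units30 0 = 0"
proof -
  have "{m. 1 \<le> m \<and> m \<le> 0 \<and> coprime m 30} = ({} :: nat set)"
    by auto
  then show ?thesis
    unfolding units30_def by (simp only: stats_empty)
qed

lemma units30_Suc:
  "units30 (Suc v) = (if coprime (Suc v) 30 then units30 v + (1, int (Suc v)) else units30 v)"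
proof (cases "coprime (Suc v) 30")
  case True
  have "{m. 1 \<le> m \<and> m \<le> Suc v \<and> coprime m 30} = {m. 1 \<le> m \<and> m \<le> v \<and> coprime m 30} \<union> {Suc v}"
    using True by (auto simp: le_Suc_eq)
  then have "units30 (Suc v) = units30 v + stats {Suc v}"
    unfolding units30_def by (subst stats_Un_disjoint[symmetric]) auto
  then show ?thesis
    using True by (simp add: stats_def)
next
  case False
  then have "{m. 1 \<le> m \<and> m \<le> Suc v \<and> coprime m 30} = {m. 1 \<le> m \<and> m \<le> v \<and> coprime m 30}"
    by (auto simp: le_Suc_eq)
  then show ?thesis
    using False by (simp add: units30_def)
qed

lemma units30_add:
  "units30 (30 * q + r) = units30 (30 * q) + units30 r + (0, 30 * int q * fst (units30 r))"
proof (induction r)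
  case 0
  then show ?case by (simp add: zero_prod_def)
next
  case (Suc r)
  have "coprime (Suc (30 * q + r)) 30 \<longleftrightarrow> coprime (Suc r) 30"
    by (metis add_Suc_right coprime_iff_gcd_eq_1 gcd.commute gcd_add_mult mult.commute add.commute)
  then show ?case
    using Suc by (auto simp: units30_Suc prod_eq_iff algebra_simps)
qed

lemma coprime_30_iff: "coprime m 30 \<longleftrightarrow> \<not> 2 dvd m \<and> \<not> 3 dvd m \<and> \<not> 5 dvd (m::nat)"
proof -
  have *: "coprime m q \<longleftrightarrow> \<not> q dvd m" if "prime q" for q :: nat
    using that by (metis coprime_absorb_left coprime_commute not_prime_unit prime_imp_coprime)
  have "coprime m (2 * (3 * 5)) \<longleftrightarrow> coprime m 2 \<and> coprime m 3 \<and> coprime m 5"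
    by (simp only: coprime_mult_right_iff)
  also have "\<dots> \<longleftrightarrow> \<not> 2 dvd m \<and> \<not> 3 dvd m \<and> \<not> 5 dvd m"
    using *[of 2] *[of 3] *[of 5] by simp
  finally show ?thesis
    by simp
qed

lemma units30_numeral:
  "units30 (numeral k) = (if 2 dvd (numeral k :: nat) \<or> 3 dvd (numeral k :: nat) \<or> 5 dvd (numeral k :: nat)
     then units30 (pred_numeral k) else units30 (pred_numeral k) + (1, numeral k))"
  using units30_Suc[of "pred_numeral k"]
  unfolding coprime_30_iff numeral_eq_Suc[symmetric] by (simp only: of_nat_numeral) auto

lemma units30_1: "units30 1 = (1, 1)"
  using units30_Suc[of 0] by simp

lemma units30_30: "units30 30 = (8, 120)"
  by (simp add: units30_numeral units30_1[simplified])

lemma units30_times_30: "units30 (30 * q) = (8 * int q, 120 * int q ^ 2)"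
proof (induction q)
  case 0
  then show ?case by (simp add: zero_prod_def)
next
  case (Suc q)
  have "units30 (30 * Suc q) = units30 (30 * q + 30)"
    by (simp add: algebra_simps)
  then show ?case
    using Suc by (simp only: units30_add) (simp add: units30_30 power2_eq_square algebra_simps)
qed

lemma prime_less_7: "prime q \<and> q < 7 \<longleftrightarrow> q = 2 \<or> q = 3 \<or> q = (5::nat)"
proof
  assume "prime q \<and> q < 7"
  moreover from this have "q \<noteq> 4" "q \<noteq> 6" "2 \<le> q"
    using prime_odd_nat[of q] prime_ge_2_nat[of q] by auto
  ultimately show "q = 2 \<or> q = 3 \<or> q = 5"
    by auto
qed auto

lemma stats_rough_7:
  assumes "5 \<le> v"
  shows "stats (rough 7 v) = units30 v + (2, 9)"
proof -
  define U where "U = {m. 1 \<le> m \<and> m \<le> v \<and> coprime m 30}"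
  have fin: "finite U"
    by (rule finite_subset[of _ "{..v}"]) (auto simp: U_def)
  have "m \<in> rough 7 v \<longleftrightarrow> m \<in> {2, 3, 5} \<union> (U - {1})" for m
  proof -
    have "m \<in> rough 7 v \<longleftrightarrow> 2 \<le> m \<and> m \<le> v \<and> (2 dvd m \<longrightarrow> 2 = m) \<and> (3 dvd m \<longrightarrow> 3 = m) \<and> (5 dvd m \<longrightarrow> 5 = m)"
      unfolding rough_def mem_Collect_eq conj_assoc[symmetric] prime_less_7 by blast
    also have "\<dots> \<longleftrightarrow> m \<in> {2, 3, 5} \<union> (U - {1})"
      using assms by (auto simp: U_def coprime_30_iff)
    finally show ?thesis .
  qed
  then have "rough 7 v = {2, 3, 5} \<union> (U - {1})"
    by blast
  moreover have "{2, 3, 5} \<inter> (U - {1}) = {}"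
    by (auto simp: U_def coprime_30_iff)
  moreover have "1 \<in> U"
    using assms by (simp add: U_def)
  ultimately have "stats (rough 7 v) = stats {2, 3, 5} + (stats U - stats {1})"
    using fin by (simp add: stats_Un_disjoint stats_Diff del: Un_insert_left)
  then show ?thesis
    by (simp add: U_def units30_def stats_def prod_eq_iff)
qed

text \<open>
  The recursion that is evaluated. It bottoms out in a table of small primes: 2213 is the first
  prime after 2208, so \<open>next_prime v\<close> can be looked up for all \<open>v < 2209\<close>.
\<close>

lemma rough_stats_rec:
  assumes "7 \<le> d" "5 \<le> v"
  shows "stats (rough d v) =
    (if v < 2209 \<and> v < d * d then stats (primes_below (next_prime v))
     else units30 v + (2, 9) - sift_step v d 7)"
proof (cases "v < 2209 \<and> v < d * d")
  case True
  then show ?thesis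
    by (simp add: rough_eq_primes_upto primes_upto_eq_below_next_prime)
next
  case False
  have "next_prime 6 = 7"
  proof (rule antisym)
    show "next_prime 6 \<le> 7"
      by (rule next_prime_le) simp_all
    show "7 \<le> next_prime 6"
      using next_prime(2)[of 6] by simp
  qed
  then have "sift_step v d 7 = stats (rough 7 v - rough d v)"
    using sifted_eq_step[of v d 6] by (simp add: sifted_def)
  also have "\<dots> = stats (rough 7 v) - stats (rough d v)"
    using assms by (simp add: stats_Diff rough_antimono)
  finally show ?thesis
    using False assms by (auto simp: stats_rough_7)
qed

section \<open>The primes below 2214\<close>

text \<open>
  The end \<open>q\<close> of the gap is an argument, so that a list of primes can be confirmed to be complete
  by walking through its gaps number by number.
\<close>

definition composite_gap :: "nat \<Rightarrow> nat \<Rightarrow> bool" where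
  "composite_gap m q \<longleftrightarrow> m \<le> q \<and> prime q \<and> (\<forall>k. m \<le> k \<and> k < q \<longrightarrow> \<not> prime k)"

lemma composite_gap_rec:
  "composite_gap m q =
    (if m = q then prime m else if prime m then False else composite_gap (Suc m) q)"
proof (cases "m < q")
  case True
  have "(\<forall>k. m \<le> k \<and> k < q \<longrightarrow> \<not> prime k) \<longleftrightarrow>
      \<not> prime m \<and> (\<forall>k. Suc m \<le> k \<and> k < q \<longrightarrow> \<not> prime k)"
    using True by (metis Suc_le_eq le_less order_refl)
  then show ?thesis
    using True unfolding composite_gap_def by (simp add: Suc_le_eq)
qed (auto simp: composite_gap_def)

lemma next_prime_eqI: "composite_gap (Suc p) q \<Longrightarrow> next_prime p = q"
  unfolding next_prime_def composite_gap_def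
  by (rule Least_equality) (auto simp: Suc_le_eq simp flip: not_less)

fun trial_division :: "nat \<Rightarrow> nat list \<Rightarrow> bool" where
  "trial_division m [] = True"
| "trial_division m (q # qs) = (if q dvd m \<and> q \<noteq> m then False else trial_division m qs)"

lemma trial_division_iff: "trial_division m qs \<longleftrightarrow> (\<forall>q\<in>set qs. q dvd m \<longrightarrow> q = m)"
  by (induction qs) auto

definition trial_primes :: "nat list" where
  "trial_primes = [2, 3, 5, 7, 11, 13, 17, 19, 23, 29, 31, 37, 41, 43, 47]"

lemma prime_less_53: "prime q \<Longrightarrow> q < 53 \<Longrightarrow> q \<in> set trial_primes"
proof -
  assume q: "prime q" "q < 53"
  \<comment> \<open>the divisors 2, 3, 5 and 7 recognise every composite number below 121\<close>
  have "\<forall>q\<in>{..<53}. 2 \<le> q \<longrightarrow> (2 dvd q \<longrightarrow> 2 = q) \<longrightarrow> (3 dvd q \<longrightarrow> 3 = q) \<longrightarrow>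
      (5 dvd q \<longrightarrow> 5 = q) \<longrightarrow> (7 dvd q \<longrightarrow> 7 = q) \<longrightarrow> q \<in> set trial_primes"
    by (simp add: trial_primes_def lessThan_nat_numeral)
  moreover have *: "a dvd q \<longrightarrow> a = q" if "prime a" for a
    using that q by (simp add: primes_dvd_imp_eq)
  have "2 dvd q \<longrightarrow> 2 = q" "3 dvd q \<longrightarrow> 3 = q" "5 dvd q \<longrightarrow> 5 = q" "7 dvd q \<longrightarrow> 7 = q"
    by (rule *; simp)+
  ultimately show "q \<in> set trial_primes"
    using q prime_ge_2_nat[of q] by blast
qed

text \<open>
  Trial division by the primes below 53 suffices here, since \<open>53 * 53 = 2809\<close>.
\<close>

lemma prime_iff_trial_division:
  assumes "2 \<le> m" "m < 2809"
  shows "prime m \<longleftrightarrow> trial_division m trial_primes"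
proof
  assume "prime m"
  have "1 \<notin> set trial_primes"
    by (simp add: trial_primes_def)
  then show "trial_division m trial_primes"
    using \<open>prime m\<close> by (auto simp: trial_division_iff prime_nat_iff)
next
  assume "trial_division m trial_primes"
  then have "m \<in> rough 53 m"
    using assms prime_less_53 by (auto simp: rough_def trial_division_iff)
  then show "prime m"
    using assms by (simp add: rough_eq_primes_upto primes_upto_def)
qed

section \<open>Rewrite rules for numerals and the prime table\<close>

text \<open>
  The numbers below are computed by rewriting with an explicit list of rules for binary numerals,
  without the simplification procedures of the default setup. For tens of thousands of small
  operations this is several times faster.
\<close>

lemma divmod_step_nat:
  "divmod_step l (q, r) = (if l \<le> r then (2 * q + 1, r - l) else (2 * q, r :: nat))"
  by simp

lemma nat_diff_numeral: "(numeral v - numeral w :: nat) = nat (numeral v - numeral w)"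
  by simp

lemma nat_small: "nat 0 = 0" "nat 1 = 1" "nat (numeral k) = numeral k" "nat (- numeral k) = 0"
  "(a::nat) - 0 = a" "(0::nat) * a = 0" "a * (0::nat) = 0"
  by simp_all

lemma div_mod_by_divmod:
  "numeral m div (numeral n :: nat) = fst (divmod m n)"
  "numeral n dvd (numeral m :: nat) \<longleftrightarrow> snd (divmod m n :: nat \<times> nat) = 0"
  by (simp_all only: fst_divmod snd_divmod dvd_eq_mod_eq_0)

lemmas num_arith = arith_simps arith_special rel_simps numeral_One simp_thms num.inject refl
  nat_diff_numeral nat_small diff_zero mult_1_left mult_1_right
  if_True if_False

lemmas nat_divmod = divmod_algorithm_code[where ?'a = nat] divmod_step_nat
  div_mod_by_divmod case_prod_conv fst_conv snd_conv

text \<open>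
  A statement about a list of consecutive primes whose unfolding produces, for each prime in the
  list, rewrite rules for its successor and for the statistics of the primes below it.
\<close>

fun prime_table :: "int \<Rightarrow> int \<Rightarrow> nat list \<Rightarrow> bool" where
  "prime_table c s [] = True"
| "prime_table c s [p] = (stats (primes_below p) = (c, s))"
| "prime_table c s (p # q # ps) =
    (stats (primes_below p) = (c, s) \<and> next_prime p = q \<and> prime_table (c + 1) (s + int p) (q # ps))"

lemma prime_table_of_successive:
  assumes "prime p" "successively (\<lambda>p. composite_gap (Suc p)) (p # ps)" "stats (primes_below p) = (c, s)"
  shows "prime_table c s (p # ps)"
  using assms
proof (induction ps arbitrary: p c s)
  case (Cons q ps)
  have q: "next_prime p = q"
    using Cons.prems by (simp add: next_prime_eqI)
  have "primes_below q = primes_upto p"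
    by (simp only: primes_upto_eq_below_next_prime q)
  also have "\<dots> = primes_below p \<union> {p}"
    using \<open>prime p\<close> by (auto simp: primes_below_def primes_upto_def)
  finally have "stats (primes_below q) = (c + 1, s + int p)"
    using Cons.prems(3) stats_Un_disjoint[of "primes_below p" "{p}"]
    by (simp add: stats_def primes_below_def del: Un_insert_right)
  moreover have "prime q"
    using next_prime(1)[of p] by (simp only: q)
  ultimately have "prime_table (c + 1) (s + int p) (q # ps)"
    using Cons.prems(2) by (intro Cons.IH) simp_all
  then show ?case
    using Cons.prems(3) q by (simp only: prime_table.simps simp_thms)
qed simp

definition small_primes :: "nat list" where
  "small_primes = [2, 3, 5, 7, 11, 13, 17, 19, 23, 29, 31, 37, 41, 43, 47, 53, 59, 61, 67, 71, 73, 79, 83, 89,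
    97, 101, 103, 107, 109, 113, 127, 131, 137, 139, 149, 151, 157, 163, 167, 173, 179, 181,
    191, 193, 197, 199, 211, 223, 227, 229, 233, 239, 241, 251, 257, 263, 269, 271, 277, 281,
    283, 293, 307, 311, 313, 317, 331, 337, 347, 349, 353, 359, 367, 373, 379, 383, 389, 397,
    401, 409, 419, 421, 431, 433, 439, 443, 449, 457, 461, 463, 467, 479, 487, 491, 499, 503,
    509, 521, 523, 541, 547, 557, 563, 569, 571, 577, 587, 593, 599, 601, 607, 613, 617, 619,
    631, 641, 643, 647, 653, 659, 661, 673, 677, 683, 691, 701, 709, 719, 727, 733, 739, 743,
    751, 757, 761, 769, 773, 787, 797, 809, 811, 821, 823, 827, 829, 839, 853, 857, 859, 863,
    877, 881, 883, 887, 907, 911, 919, 929, 937, 941, 947, 953, 967, 971, 977, 983, 991, 997,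
    1009, 1013, 1019, 1021, 1031, 1033, 1039, 1049, 1051, 1061, 1063, 1069, 1087, 1091, 1093,
    1097, 1103, 1109, 1117, 1123, 1129, 1151, 1153, 1163, 1171, 1181, 1187, 1193, 1201, 1213,
    1217, 1223, 1229, 1231, 1237, 1249, 1259, 1277, 1279, 1283, 1289, 1291, 1297, 1301, 1303,
    1307, 1319, 1321, 1327, 1361, 1367, 1373, 1381, 1399, 1409, 1423, 1427, 1429, 1433, 1439,
    1447, 1451, 1453, 1459, 1471, 1481, 1483, 1487, 1489, 1493, 1499, 1511, 1523, 1531, 1543,
    1549, 1553, 1559, 1567, 1571, 1579, 1583, 1597, 1601, 1607, 1609, 1613, 1619, 1621, 1627,
    1637, 1657, 1663, 1667, 1669, 1693, 1697, 1699, 1709, 1721, 1723, 1733, 1741, 1747, 1753,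
    1759, 1777, 1783, 1787, 1789, 1801, 1811, 1823, 1831, 1847, 1861, 1867, 1871, 1873, 1877,
    1879, 1889, 1901, 1907, 1913, 1931, 1933, 1949, 1951, 1973, 1979, 1987, 1993, 1997, 1999,
    2003, 2011, 2017, 2027, 2029, 2039, 2053, 2063, 2069, 2081, 2083, 2087, 2089, 2099, 2111,
    2113, 2129, 2131, 2137, 2141, 2143, 2153, 2161, 2179, 2203, 2207, 2213]"

lemma Suc_numeral_inc: "Suc (numeral m) = numeral (Num.inc m)"
  by (simp only: Suc_numeral add_One)

lemma composite_gap_numeral:
  "composite_gap (numeral m) (numeral q) =
    (if m = q then prime (numeral m :: nat)
     else if prime (numeral m :: nat) then False else composite_gap (numeral (Num.inc m)) (numeral q))"
  unfolding Suc_numeral_inc[symmetric] numeral_eq_iff[where ?'a = nat, symmetric]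
  by (rule composite_gap_rec)

lemma successive_small_primes: "successively (\<lambda>p. composite_gap (Suc p)) small_primes"
  unfolding small_primes_def
  by (simp only: successively.simps composite_gap_numeral Suc_numeral_inc num_arith inc.simps
      prime_iff_trial_division[unfolded trial_primes_def] trial_division.simps nat_divmod
      cong: if_weak_cong)

lemma prime_table_small_primes: "prime_table 0 0 small_primes"
proof -
  have "\<not> (prime q \<and> q < 2)" for q :: nat
    using prime_ge_2_nat[of q] by linarith
  then have "stats (primes_below 2) = (0, 0)"
    by (simp only: primes_below_def) (simp add: zero_prod_def)
  then show ?thesis
    using successive_small_primes unfolding small_primes_def
    by (intro prime_table_of_successive two_is_prime_nat)
qed

lemmas prime_table_entries =
  prime_table_small_primes[unfolded small_primes_def, simplified prime_table.simps of_nat_numeral num_arith]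

text \<open>
  The successor of an arbitrary \<open>v\<close> is found by stepping through the table from the first prime
  in the row of 32 integers that contains \<open>v\<close>.
\<close>

definition row_start :: "nat \<Rightarrow> nat" where
  "row_start q = (LEAST p. prime p \<and> 32 * q \<le> p)"

lemma row_start_eq_iff: "row_start q = p \<longleftrightarrow> composite_gap (32 * q) p"
proof -
  have ex: "\<exists>p. prime p \<and> 32 * q \<le> p"
    using bigger_prime[of "32 * q"] by (auto intro: less_imp_le)
  show ?thesis
  proof
    assume "row_start q = p"
    then show "composite_gap (32 * q) p"
      using LeastI_ex[OF ex] not_less_Least[of _ "\<lambda>p. prime p \<and> 32 * q \<le> p"]
      unfolding row_start_def composite_gap_def by blast
  next
    assume "composite_gap (32 * q) p"
    then show "row_start q = p"
      unfolding row_start_def composite_gap_def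
      by (intro Least_equality) (auto simp flip: not_less)
  qed
qed

lemma composite_gap_0: "composite_gap 0 q \<longleftrightarrow> composite_gap 2 q"
  unfolding composite_gap_def by (auto dest: prime_ge_2_nat)

lemma row_starts:
  "map row_start [0, 1, 2, 3, 4, 5, 6, 7, 8, 9, 10, 11, 12, 13, 14, 15, 16, 17, 18, 19, 20, 21, 22, 23, 24, 25,
    26, 27, 28, 29, 30, 31, 32, 33, 34, 35, 36, 37, 38, 39, 40, 41, 42, 43, 44, 45, 46, 47, 48,
    49, 50, 51, 52, 53, 54, 55, 56, 57, 58, 59, 60, 61, 62, 63, 64, 65, 66, 67, 68, 69] =
   [2, 37, 67, 97, 131, 163, 193, 227, 257, 293, 331, 353, 389, 419, 449, 487, 521, 547, 577,
    613, 641, 673, 709, 739, 769, 809, 839, 877, 907, 929, 967, 997, 1031, 1061, 1091, 1123,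
    1153, 1187, 1217, 1249, 1283, 1319, 1361, 1381, 1409, 1447, 1481, 1511, 1543, 1571, 1601,
    1637, 1667, 1697, 1733, 1777, 1801, 1831, 1861, 1889, 1931, 1973, 1987, 2017, 2053, 2081,
    2113, 2153, 2179, 2213]"
  by (simp only: list.map list.inject row_start_eq_iff composite_gap_0 composite_gap_numeral
      Suc_numeral_inc num_arith inc.simps
      prime_iff_trial_division[unfolded trial_primes_def] trial_division.simps nat_divmod
      cong: if_weak_cong)

lemmas row_start_entries = row_starts[simplified list.map list.inject num_arith]

function prime_after :: "nat \<Rightarrow> nat \<Rightarrow> nat" where
  "prime_after v p = (if v < p then p else prime_after v (next_prime p))"
  by auto
termination
  by (relation "measure (\<lambda>(v, p). Suc v - p)") (auto simp: next_prime(2) intro: diff_less_mono2 less_SucI)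

declare prime_after.simps [simp del]

lemma prime_after_eq_next_prime:
  assumes "prime p" "\<And>q. prime q \<Longrightarrow> v < q \<Longrightarrow> p \<le> q"
  shows "prime_after v p = next_prime v"
  using assms
proof (induction v p rule: prime_after.induct)
  case (1 v p)
  show ?case
  proof (cases "v < p")
    case True
    then have "next_prime v = p"
      using 1 next_prime[of v] by (intro antisym next_prime_le) auto
    then show ?thesis
      using True by (simp add: prime_after.simps)
  next
    case False
    then have "prime_after v (next_prime p) = next_prime v"
      by (intro 1) (auto intro: next_prime next_prime_le)
    then show ?thesis
      using False by (simp add: prime_after.simps[of v p])
  qed
qed

lemma next_prime_eq_prime_after: "next_prime v = prime_after v (row_start (v div 32))"
proof -
  have *: "composite_gap (32 * (v div 32)) (row_start (v div 32))"
    using row_start_eq_iff by blast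
  have "32 * (v div 32) \<le> v"
    by simp
  show ?thesis
  proof (rule prime_after_eq_next_prime[symmetric])
    show "prime (row_start (v div 32))"
      using * by (simp add: composite_gap_def)
    show "row_start (v div 32) \<le> q" if "prime q" "v < q" for q
      using * that \<open>32 * (v div 32) \<le> v\<close> unfolding composite_gap_def
      by (meson leI less_imp_le order_trans)
  qed
qed

section \<open>Evaluation of the sieve\<close>

text \<open>
  With \<open>v = 30 * k + r\<close> and \<open>x = units30 r\<close>, this is \<open>units30 v + (2, 9)\<close>: the correction trades
  the unit 1 for the primes 2, 3 and 5.
\<close>

definition wheel30_sum :: "int \<Rightarrow> int \<times> int \<Rightarrow> int \<times> int" where
  "wheel30_sum k x = (8 * k + (fst x + 2), k * (120 * k + 30 * fst x) + (snd x + 9))"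

definition wheel30 :: "nat \<times> nat \<Rightarrow> int \<times> int" where
  "wheel30 qr = wheel30_sum (int (fst qr)) (units30 (snd qr))"

lemma stats_wheel: "units30 v + (2, 9) = wheel30 (v div 30, v mod 30)"
proof -
  have "units30 v = units30 (30 * (v div 30) + v mod 30)"
    by simp
  then show ?thesis
    by (simp only: units30_add units30_times_30)
      (simp add: wheel30_def wheel30_sum_def prod_eq_iff power2_eq_square algebra_simps)
qed

lemma units30_table:
  "map units30 [0, 1, 2, 3, 4, 5, 6, 7, 8, 9, 10, 11, 12, 13, 14, 15, 16, 17, 18, 19, 20, 21, 22, 23,
      24, 25, 26, 27, 28, 29] =
   [(0, 0), (1, 1), (1, 1), (1, 1), (1, 1), (1, 1), (1, 1), (2, 8), (2, 8), (2, 8), (2, 8), (3, 19),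
    (3, 19), (4, 32), (4, 32), (4, 32), (4, 32), (5, 49), (5, 49), (6, 68), (6, 68), (6, 68), (6, 68),
    (7, 91), (7, 91), (7, 91), (7, 91), (7, 91), (7, 91), (8, 120)]"
  by (simp only: list.map list.inject units30_numeral units30_0 units30_1 zero_prod_def add_Pair prod.inject
      pred_numeral_simps BitM.simps num_arith nat_divmod cong: if_weak_cong)

lemmas units30_entries = units30_table[simplified list.map list.inject num_arith]

lemma stats_rough_numeral:
  assumes "7 \<le> (numeral d :: nat)" "5 \<le> (numeral v :: nat)"
  shows "stats (rough (numeral d) (numeral v)) =
    (if numeral v < (2209 :: nat) \<and> numeral v < (numeral d * numeral d :: nat)
     then stats (primes_below (prime_after (numeral v) (row_start (numeral v div 32))))
     else wheel30 (divmod v (Num.Bit0 (Num.Bit1 (Num.Bit1 (Num.Bit1 Num.One))))) -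
       sift_step (numeral v) (numeral d) 7)"
  using rough_stats_rec[OF assms] by (simp only: next_prime_eq_prime_after stats_wheel divmod_def)

lemma sift_step_numeral:
  "sift_step (numeral v) (numeral d) (numeral p) =
    (if numeral p < (numeral d :: nat) \<and> numeral p * numeral p \<le> (numeral v :: nat)
     then scale (numeral p) (stats (rough (numeral p) (numeral v div numeral p)) -
         stats (primes_below (numeral p))) +
       sift_step (numeral v) (numeral d) (next_prime (numeral p))
     else (0, 0))"
  by (simp only: sift_step_def[of "numeral v" "numeral d" "numeral p"] sifted_eq_step of_nat_numeral)

lemma scale_Pair: "scale k (a, b) = (a, k * b)"
  by (simp add: scale_def)

lemma wheel30_Pair: "wheel30 (q, r) = wheel30_sum (int q) (units30 r)"
  by (simp add: wheel30_def)

lemma wheel30_sum_Pair: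
  "wheel30_sum k (c, s) = (8 * k + (c + 2), k * (120 * k + 30 * c) + (s + 9))"
  by (simp add: wheel30_sum_def)

text \<open>
  \<open>1018081 = 1009 * 1009\<close>, where 1009 is the first prime after 1000.
\<close>

lemma stats_primes_upto:
  assumes "v < 1018081"
  shows "stats (primes_upto v) = stats (rough 1009 v)"
  using assms by (simp add: rough_eq_primes_upto)

lemmas sieve_eval = stats_primes_upto stats_rough_numeral sift_step_numeral prime_after.simps[of "numeral v" "numeral p" for v p]
  prime_table_entries row_start_entries units30_entries scale_Pair wheel30_Pair wheel30_sum_Pair
  add_Pair diff_Pair of_nat_numeral of_nat_0 of_nat_1 nat_divmod num_arith

section \<open>Logarithms of 7-smooth numbers\<close>

lemma ln_small_primes_bounds:
  "69314718 / 10 ^ 8 \<le> ln (2::real)" "ln (2::real) \<le> 69314719 / 10 ^ 8"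
  "109861228 / 10 ^ 8 \<le> ln (3::real)" "ln (3::real) \<le> 109861229 / 10 ^ 8"
  "160943791 / 10 ^ 8 \<le> ln (5::real)" "ln (5::real) \<le> 160943792 / 10 ^ 8"
  "194591014 / 10 ^ 8 \<le> ln (7::real)" "ln (7::real) \<le> 194591015 / 10 ^ 8"
proof -
  have l2: "6931471805 / 10 ^ 10 \<le> ln (2::real)" "ln (2::real) \<le> 6931471806 / 10 ^ 10"
    using ln_approx_bounds[of 2 11] by (simp_all add: eval_nat_numeral)
  \<comment> \<open>the quotients 3/2, 5/4 and 8/7 are near 1, where the series converges fast\<close>
  have l3: "4054651081 / 10 ^ 10 \<le> ln (3 / 2 :: real)" "ln (3 / 2 :: real) \<le> 4054651082 / 10 ^ 10"
    using ln_approx_bounds[of "3 / 2" 8] by (simp_all add: eval_nat_numeral)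
  have l5: "2231435513 / 10 ^ 10 \<le> ln (5 / 4 :: real)" "ln (5 / 4 :: real) \<le> 2231435514 / 10 ^ 10"
    using ln_approx_bounds[of "5 / 4" 6] by (simp_all add: eval_nat_numeral)
  have l7: "1335313926 / 10 ^ 10 \<le> ln (8 / 7 :: real)" "ln (8 / 7 :: real) \<le> 1335313927 / 10 ^ 10"
    using ln_approx_bounds[of "8 / 7" 5] by (simp_all add: eval_nat_numeral)
  have 4: "ln (4::real) = 2 * ln 2" and 8: "ln (8::real) = 3 * ln 2"
    using ln_realpow[of 2 2] ln_realpow[of 2 3] by simp_all
  have "ln (3 / 2 :: real) = ln 3 - ln 2" "ln (5 / 4 :: real) = ln 5 - 2 * ln 2"
    "ln (8 / 7 :: real) = 3 * ln 2 - ln 7"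
    by (simp_all add: ln_div 4 8)
  then show
    "69314718 / 10 ^ 8 \<le> ln (2::real)" "ln (2::real) \<le> 69314719 / 10 ^ 8"
    "109861228 / 10 ^ 8 \<le> ln (3::real)" "ln (3::real) \<le> 109861229 / 10 ^ 8"
    "160943791 / 10 ^ 8 \<le> ln (5::real)" "ln (5::real) \<le> 160943792 / 10 ^ 8"
    "194591014 / 10 ^ 8 \<le> ln (7::real)" "ln (7::real) \<le> 194591015 / 10 ^ 8"
    using l2 l3 l5 l7 by simp_all
qed

text \<open>
  All logarithms in the estimates are taken at numbers without prime factors above 7, so that four
  numerical constants suffice. A number is given by its exponents of 2, 3, 5 and 7, and logarithms
  are bounded in units of \<open>10 ^ - 8\<close>, which turns the numerical checks into integer arithmetic.
\<close>

type_synonym exponents = "nat \<times> nat \<times> nat \<times> nat"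

fun smooth :: "exponents \<Rightarrow> nat" where
  "smooth (i, j, k, l) = 2 ^ i * 3 ^ j * 5 ^ k * 7 ^ l"

fun log_floor :: "exponents \<Rightarrow> int" where
  "log_floor (i, j, k, l) =
    69314718 * int i + 109861228 * int j + 160943791 * int k + 194591014 * int l"

fun log_ceiling :: "exponents \<Rightarrow> int" where
  "log_ceiling (i, j, k, l) =
    69314719 * int i + 109861229 * int j + 160943792 * int k + 194591015 * int l"

lemma smooth_pos: "0 < smooth e"
  by (cases e) simp

lemma ln_smooth:
  "real_of_int (log_floor e) / 10 ^ 8 \<le> ln (real (smooth e))"
  "ln (real (smooth e)) \<le> real_of_int (log_ceiling e) / 10 ^ 8"
proof -
  obtain i j k l where e: "e = (i, j, k, l)"
    by (cases e)
  have ln: "ln (real (smooth e)) = real i * ln 2 + real j * ln 3 + real k * ln 5 + real l * ln 7"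
    by (simp add: e ln_mult ln_realpow)
  note b = ln_small_primes_bounds[THEN mult_left_mono[OF _ of_nat_0_le_iff]]
  show "real_of_int (log_floor e) / 10 ^ 8 \<le> ln (real (smooth e))"
    unfolding ln using b(1)[of i] b(3)[of j] b(5)[of k] b(7)[of l] by (simp add: e add_divide_distrib)
  show "ln (real (smooth e)) \<le> real_of_int (log_ceiling e) / 10 ^ 8"
    unfolding ln using b(2)[of i] b(4)[of j] b(6)[of k] b(8)[of l] by (simp add: e add_divide_distrib)
qed

section \<open>Tangents and chords of x / (ln x - B)\<close>

definition log_quotient :: "real \<Rightarrow> real \<Rightarrow> real" where
  "log_quotient B x = x / (ln x - B)"

text \<open>
  \<open>exp (- t)\<close> is at least its Pade approximant \<open>(2 - t) / (2 + t)\<close> for nonnegative \<open>t\<close>.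
\<close>

lemma two_plus_exp_bound:
  fixes t :: real
  assumes "0 \<le> t"
  shows "2 - t \<le> (2 + t) * exp (- t)"
proof -
  let ?f = "\<lambda>t::real. (2 + t) * exp (- t) + t"
  have "?f 0 \<le> ?f t"
  proof (rule DERIV_nonneg_imp_nondecreasing[OF assms])
    fix x :: real
    assume "0 \<le> x" "x \<le> t"
    have "(?f has_real_derivative 1 - (1 + x) * exp (- x)) (at x)"
      by (auto intro!: derivative_eq_intros simp: algebra_simps)
    moreover have "(1 + x) * exp (- x) \<le> exp x * exp (- x)"
      by (intro mult_right_mono) (simp_all add: exp_ge_add_one_self)
    ultimately show "\<exists>y. (?f has_real_derivative y) (at x) \<and> 0 \<le> y"
      by (auto simp: exp_add[symmetric])
  qed
  then show ?thesis
    by simp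
qed

text \<open>
  The tangent inequality for \<open>x / (ln x - B)\<close> in the variable \<open>u = ln x - B\<close>, with point of
  contact \<open>u = r\<close>. With \<open>t = u - r\<close> it reads \<open>exp (- t) \<ge> 1 - t + t\<^sup>2 / u\<close>. For
  \<open>t \<ge> 0\<close> one has \<open>u \<ge> 2 + t\<close>, and the right-hand side is at most \<open>(2 - t) / (2 + t)\<close>; for
  \<open>t < 0\<close> one has \<open>u \<ge> 2\<close>, and the quadratic Taylor polynomial of \<open>exp (- t)\<close> dominates it.
\<close>

lemma exp_tangent_bound:
  fixes r u :: real
  assumes "2 \<le> r" "2 \<le> u"
  shows "u - r * (u - r) \<le> u * exp (r - u)"
proof (cases "r \<le> u")
  case True
  define t where "t = u - r"
  have t: "0 \<le> t" "2 + t \<le> u"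
    using True assms by (auto simp: t_def)
  have "t * t / u \<le> t * t / (2 + t)"
    using t by (intro divide_left_mono) auto
  also have "\<dots> = (2 - t) / (2 + t) - 1 + t"
    using t by (simp add: field_simps)
  also have "(2 - t) / (2 + t) \<le> exp (- t)"
    using t two_plus_exp_bound[of t] by (simp add: divide_le_eq mult.commute)
  finally have "t * t \<le> (exp (- t) - 1 + t) * u"
    using t by (simp add: divide_le_eq)
  then have "u - (u - t) * t \<le> u * exp (- t)"
    by (simp add: algebra_simps)
  then show ?thesis
    by (simp add: t_def)
next
  case False
  define s where "s = r - u"
  have s: "0 \<le> s"
    using False by (auto simp: s_def)
  have "s\<^sup>2 \<le> u * s\<^sup>2 / 2"
    using assms mult_right_mono[of 2 u "s\<^sup>2"] by simp
  then have "u + (u + s) * s \<le> u * (1 + s + s\<^sup>2 / 2)"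
    by (simp add: power2_eq_square algebra_simps)
  also have "\<dots> \<le> u * exp s"
    using assms s exp_lower_Taylor_quadratic[of s] by (intro mult_left_mono) auto
  finally have "u - (u + s) * (- s) \<le> u * exp s"
    by simp
  then show ?thesis
    by (simp add: s_def)
qed

text \<open>
  The function \<open>x / (ln x - B)\<close> is concave where \<open>ln x - B \<ge> 2\<close>. For \<open>r = ln m - B\<close> the
  right-hand side is its tangent at \<open>m\<close>. A smaller \<open>r\<close> belongs to the tangent at a point below
  \<open>m\<close>, shifted upwards, so a rational lower bound for \<open>ln m - B\<close> may take the place of the
  logarithm and no logarithm is left on the right.
\<close>

lemma log_quotient_le_tangent:
  fixes x m B r :: real
  assumes "0 < x" "0 < m" "2 \<le> ln x - B" "2 \<le> r" "r \<le> ln m - B"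
  shows "log_quotient B x \<le> x / r - (x - m) / r\<^sup>2"
proof -
  define u where "u = ln x - B"
  have u: "2 \<le> u"
    using assms by (simp add: u_def)
  have "x * exp (r - u) = exp (r + B)"
    using assms by (simp add: u_def exp_diff exp_add)
  also have "\<dots> \<le> m"
    using assms by (simp add: ln_ge_iff[symmetric])
  finally have m: "x * exp (r - u) \<le> m" .
  have "x * (u - r * (u - r)) \<le> x * (u * exp (r - u))"
    using assms u by (intro mult_left_mono exp_tangent_bound) auto
  also have "\<dots> = u * (x * exp (r - u))"
    by simp
  also have "\<dots> \<le> u * m"
    using m u by (intro mult_left_mono) auto
  finally have "x * r\<^sup>2 \<le> (x * r - (x - m)) * u"
    by (simp add: algebra_simps power2_eq_square)
  then have "x / u \<le> (x * r - (x - m)) / r\<^sup>2"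
    using u assms(4) by (simp add: field_simps)
  also have "\<dots> = x / r - (x - m) / r\<^sup>2"
    using assms(4) by (simp add: diff_divide_distrib power2_eq_square)
  finally show ?thesis
    by (simp add: log_quotient_def u_def)
qed

text \<open>
  The tangent at \<open>x\<close> lies above the graph at \<open>a\<close> and at \<open>b\<close>; combine the two inequalities with
  the weights that make the affine function take its value at \<open>x\<close>.
\<close>

lemma log_quotient_ge_chord:
  fixes a b x B :: real
  assumes "0 < a" "a \<le> x" "x \<le> b" "2 \<le> ln a - B"
  shows "(b - x) * log_quotient B a + (x - a) * log_quotient B b \<le> (b - a) * log_quotient B x"
proof -
  define r where "r = ln x - B"
  have "0 < x" "0 < b" "a \<le> b"
    using assms by linarith+
  then have "ln a \<le> ln x" "ln a \<le> ln b"
    using assms by (simp_all only: ln_le_cancel_iff)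
  then have r: "2 \<le> r" and b: "2 \<le> ln b - B"
    using assms(4) unfolding r_def by linarith+
  have tangent: "log_quotient B y \<le> y / r - (y - x) / r\<^sup>2" if "0 < y" "2 \<le> ln y - B" for y
    using that r \<open>0 < x\<close> by (intro log_quotient_le_tangent) (simp_all only: r_def order_refl)
  have "(b - x) * log_quotient B a + (x - a) * log_quotient B b
      \<le> (b - x) * (a / r - (a - x) / r\<^sup>2) + (x - a) * (b / r - (b - x) / r\<^sup>2)"
    using assms b \<open>0 < b\<close> by (intro add_mono mult_left_mono tangent) simp_all
  also have "\<dots> = (b - a) * (x / r)"
    by (simp only: divide_inverse) algebra
  finally show ?thesis
    by (simp only: log_quotient_def r_def)
qed

section \<open>Sums over blocks of primes\<close>

definition prime_sum :: "real \<Rightarrow> nat \<Rightarrow> nat \<Rightarrow> real" where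
  "prime_sum B a b = (\<Sum>p\<in>primes_upto b - primes_upto a. log_quotient B (real p))"

lemma primes_upto_mono: "a \<le> b \<Longrightarrow> primes_upto a \<subseteq> primes_upto b"
  by (auto simp: primes_upto_def)

lemma prime_sum_split:
  assumes "a \<le> b" "b \<le> c"
  shows "prime_sum B a c = prime_sum B a b + prime_sum B b c"
proof -
  have "primes_upto c - primes_upto a = (primes_upto b - primes_upto a) \<union> (primes_upto c - primes_upto b)"
    using assms by (auto simp: primes_upto_def)
  then show ?thesis
    using primes_upto_mono[OF assms(1)] unfolding prime_sum_def
    by (simp only:) (rule sum.union_disjoint; auto)
qed

definition block_stats :: "nat \<Rightarrow> nat \<Rightarrow> int \<times> int" where
  "block_stats a b = stats (primes_upto b) - stats (primes_upto a)"

lemma block_stats_eq: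
  assumes "a \<le> b"
  shows "real_of_int (fst (block_stats a b)) = real (card (primes_upto b - primes_upto a))"
    "real_of_int (snd (block_stats a b)) = (\<Sum>p\<in>primes_upto b - primes_upto a. real p)"
  using stats_Diff[OF finite_primes_upto primes_upto_mono[OF assms], symmetric]
  by (simp_all add: block_stats_def stats_def)

text \<open>
  An affine function summed over a set of primes depends only on the number \<open>c\<close> and the sum \<open>s\<close>
  of these primes. This is what reduces the estimates to the output of the sieve.
\<close>

lemma prime_sum_le_tangent:
  fixes m r B :: real
  assumes "a \<le> b" "0 < a" "2 \<le> ln (real a) - B" "0 < m" "2 \<le> r" "r \<le> ln m - B"
  defines "c \<equiv> real_of_int (fst (block_stats a b))" and "s \<equiv> real_of_int (snd (block_stats a b))"
  shows "prime_sum B a b \<le> s / r - (s - m * c) / r\<^sup>2"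
proof -
  let ?P = "primes_upto b - primes_upto a"
  have "prime_sum B a b \<le> (\<Sum>p\<in>?P. real p / r - (real p - m) / r\<^sup>2)"
    unfolding prime_sum_def
  proof (rule sum_mono)
    fix p assume "p \<in> ?P"
    then have "a \<le> p"
      by (auto simp: primes_upto_def)
    then have "ln (real a) \<le> ln (real p)" "0 < real p"
      using \<open>0 < a\<close> by simp_all
    then show "log_quotient B (real p) \<le> real p / r - (real p - m) / r\<^sup>2"
      using assms by (intro log_quotient_le_tangent) linarith+
  qed
  also have "\<dots> = s / r - (s - m * c) / r\<^sup>2"
    unfolding c_def s_def block_stats_eq[OF \<open>a \<le> b\<close>]
    by (simp add: sum_subtractf sum_divide_distrib[symmetric] mult.commute)
  finally show ?thesis .
qed

lemma prime_sum_ge_chord: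
  fixes A C B :: real
  assumes "a \<le> b" "0 < a" "2 \<le> ln (real a) - B"
    and "A \<le> log_quotient B (real a)" "C \<le> log_quotient B (real b)"
  defines "c \<equiv> real_of_int (fst (block_stats a b))" and "s \<equiv> real_of_int (snd (block_stats a b))"
  shows "(real b * c - s) * A + (s - real a * c) * C \<le> (real b - real a) * prime_sum B a b"
proof -
  let ?P = "primes_upto b - primes_upto a"
  have "(real b * c - s) * A + (s - real a * c) * C = (\<Sum>p\<in>?P. (real b - real p) * A + (real p - real a) * C)"
    unfolding c_def s_def block_stats_eq[OF \<open>a \<le> b\<close>]
    by (simp add: sum.distrib sum_subtractf flip: sum_distrib_right) (simp add: mult.commute)
  also have "\<dots> \<le> (\<Sum>p\<in>?P. (real b - real a) * log_quotient B (real p))"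
  proof (rule sum_mono)
    fix p assume "p \<in> ?P"
    then have p: "real a \<le> real p" "real p \<le> real b"
      by (auto simp: primes_upto_def)
    then have "(real b - real p) * A + (real p - real a) * C
        \<le> (real b - real p) * log_quotient B (real a) + (real p - real a) * log_quotient B (real b)"
      using assms by (intro add_mono mult_left_mono) auto
    also have "\<dots> \<le> (real b - real a) * log_quotient B (real p)"
      using p assms by (intro log_quotient_ge_chord) auto
    finally show "(real b - real p) * A + (real p - real a) * C
        \<le> (real b - real a) * log_quotient B (real p)" .
  qed
  also have "\<dots> = (real b - real a) * prime_sum B a b"
    by (simp add: prime_sum_def sum_distrib_left)
  finally show ?thesis .
qed

text \<open>
  The bound of \<open>prime_sum_le_tangent\<close> by \<open>k\<close>, multiplied by the square of the
  slope parameter and scaled by \<open>10 ^ 16\<close>: the actual parameter is \<open>r / 10 ^ 8\<close>.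
\<close>

definition tangent_check :: "int \<Rightarrow> int \<Rightarrow> int \<times> int \<Rightarrow> int \<Rightarrow> bool" where
  "tangent_check r m cs k \<longleftrightarrow>
    2 * 10 ^ 8 \<le> r \<and> 10 ^ 8 * (snd cs * r - 10 ^ 8 * (snd cs - m * fst cs)) \<le> k * r\<^sup>2"

text \<open>
  A block is given by its upper end \<open>b\<close>, the exponents \<open>e\<close> of the point of contact and an integer
  bound \<open>k\<close>; its lower end is the upper end of the block before. The parameter \<open>B\<close> is
  \<open>\<beta> / 10 ^ 8\<close>.
\<close>

fun tangent_certificate :: "int \<Rightarrow> nat \<Rightarrow> (nat \<times> exponents \<times> int) list \<Rightarrow> bool" where
  "tangent_certificate \<beta> a [] = True"
| "tangent_certificate \<beta> a ((b, e, k) # blocks) =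
    (a \<le> b \<and> tangent_check (log_floor e - \<beta>) (int (smooth e)) (block_stats a b) k \<and>
     tangent_certificate \<beta> b blocks)"

lemma tangent_check_bound:
  assumes "tangent_check (log_floor e - \<beta>) (int (smooth e)) (block_stats a b) k"
    and "a \<le> b" "0 < a" "2 \<le> ln (real a) - B" and B: "B = real_of_int \<beta> / 10 ^ 8"
  shows "prime_sum B a b \<le> real_of_int k"
proof -
  define \<rho> where "\<rho> = log_floor e - \<beta>"
  define r where "r = real_of_int \<rho> / 10 ^ 8"
  define m where "m = real (smooth e)"
  define c where "c = real_of_int (fst (block_stats a b))"
  define s where "s = real_of_int (snd (block_stats a b))"
  have "2 * 10 ^ 8 \<le> \<rho>"
    and "10 ^ 8 * (snd (block_stats a b) * \<rho> - 10 ^ 8 * (snd (block_stats a b) - int (smooth e) * fst (block_stats a b)))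
      \<le> k * \<rho>\<^sup>2"
    using assms(1) by (auto simp: tangent_check_def \<rho>_def)
  then have "real_of_int (2 * 10 ^ 8) \<le> real_of_int \<rho>"
    and "real_of_int (10 ^ 8 * (snd (block_stats a b) * \<rho> - 10 ^ 8 * (snd (block_stats a b) - int (smooth e) * fst (block_stats a b))))
      \<le> real_of_int (k * \<rho>\<^sup>2)"
    by (simp_all only: of_int_le_iff)
  then have r: "2 \<le> r"
    and "10 ^ 8 * (s * (10 ^ 8 * r) - 10 ^ 8 * (s - m * c)) \<le> real_of_int k * (10 ^ 8 * r)\<^sup>2"
    by (simp_all add: r_def m_def c_def s_def)
  then have check: "s * r - (s - m * c) \<le> real_of_int k * r\<^sup>2"
    by (simp add: power_mult_distrib algebra_simps)
  have "prime_sum B a b \<le> s / r - (s - m * c) / r\<^sup>2"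
    unfolding c_def s_def
  proof (rule prime_sum_le_tangent)
    show "r \<le> ln m - B"
      using ln_smooth(1)[of e] by (simp add: r_def \<rho>_def m_def B diff_divide_distrib)
  qed (use assms r in \<open>simp_all add: m_def smooth_pos\<close>)
  also have "\<dots> = (s * r - (s - m * c)) / r\<^sup>2"
    using r by (simp add: field_simps power2_eq_square)
  also have "\<dots> \<le> real_of_int k"
    using r check by (simp add: divide_le_eq)
  finally show ?thesis .
qed

lemma tangent_certificate_le_last:
  "tangent_certificate \<beta> a blocks \<Longrightarrow> a \<le> last (a # map fst blocks)"
  by (induction blocks arbitrary: a) (fastforce split: if_splits)+

lemma prime_sum_le_of_certificate:
  assumes "tangent_certificate \<beta> a blocks" "0 < a" "2 \<le> ln (real a) - B" "B = real_of_int \<beta> / 10 ^ 8"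
  shows "prime_sum B a (last (a # map fst blocks)) \<le> real_of_int (\<Sum>(b, e, k)\<leftarrow>blocks. k)"
  using assms(1-3)
proof (induction blocks arbitrary: a)
  case Nil
  then show ?case by (simp add: prime_sum_def)
next
  case (Cons block blocks)
  obtain b e k where block: "block = (b, e, k)"
    by (cases block)
  let ?c = "last (b # map fst blocks)"
  have cert: "a \<le> b" "tangent_check (log_floor e - \<beta>) (int (smooth e)) (block_stats a b) k"
    "tangent_certificate \<beta> b blocks"
    using Cons.prems(1) by (simp_all add: block)
  have "ln (real a) \<le> ln (real b)"
    using cert(1) Cons.prems(2) by simp
  then have "2 \<le> ln (real b) - B"
    using Cons.prems(3) by linarith
  then have "prime_sum B b ?c \<le> real_of_int (\<Sum>(b, e, k)\<leftarrow>blocks. k)"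
    using Cons cert by (intro Cons.IH) auto
  moreover have "prime_sum B a b \<le> real_of_int k"
    using Cons.prems cert assms(4) by (intro tangent_check_bound)
  moreover have "prime_sum B a ?c = prime_sum B a b + prime_sum B b ?c"
    using cert by (intro prime_sum_split tangent_certificate_le_last)
  ultimately show ?case
    by (simp add: block)
qed

text \<open>
  The bound of \<open>prime_sum_ge_chord\<close> by \<open>k\<close>, with denominators cleared. Here \<open>q / 10 ^ 8\<close> and
  \<open>r / 10 ^ 8\<close> are upper bounds for \<open>ln x - B\<close> at the ends \<open>a\<close> and \<open>b\<close>.
\<close>

definition chord_check :: "int \<Rightarrow> int \<Rightarrow> int \<Rightarrow> int \<Rightarrow> int \<times> int \<Rightarrow> int \<Rightarrow> bool" where
  "chord_check a b q r cs k \<longleftrightarrow>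
    k * ((b - a) * (q * r)) \<le>
      10 ^ 8 * (a * r * (b * fst cs - snd cs) + b * q * (snd cs - a * fst cs))"

text \<open>
  Here \<open>e\<close> are the exponents of the end \<open>b\<close> itself, and the upper bound \<open>q\<close> for the logarithm
  at \<open>a\<close> is handed on from block to block.
\<close>

fun chord_certificate :: "int \<Rightarrow> nat \<Rightarrow> int \<Rightarrow> (nat \<times> exponents \<times> int) list \<Rightarrow> bool" where
  "chord_certificate \<beta> a q [] = True"
| "chord_certificate \<beta> a q ((b, e, k) # blocks) =
    (a < b \<and> smooth e = b \<and> chord_check (int a) (int b) q (log_ceiling e - \<beta>) (block_stats a b) k \<and>
     chord_certificate \<beta> b (log_ceiling e - \<beta>) blocks)"

lemma chord_check_bound:
  assumes "chord_check (int a) (int b) q r (block_stats a b) k"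
    and ab: "a < b" "0 < a" "2 \<le> ln (real a) - B"
    and q: "ln (real a) - B \<le> real_of_int q / 10 ^ 8" and r: "ln (real b) - B \<le> real_of_int r / 10 ^ 8"
  shows "real_of_int k \<le> prime_sum B a b"
proof -
  define q' where "q' = real_of_int q / 10 ^ 8"
  define r' where "r' = real_of_int r / 10 ^ 8"
  define c where "c = real_of_int (fst (block_stats a b))"
  define s where "s = real_of_int (snd (block_stats a b))"
  have "ln (real a) \<le> ln (real b)"
    using ab by simp
  then have pos: "0 < ln (real a) - B" "0 < ln (real b) - B" "0 < q'" "0 < r'"
    using ab(3) q r unfolding q'_def r'_def by linarith+
  have "real_of_int (k * ((int b - int a) * (q * r))) \<le>
      real_of_int (10 ^ 8 * (int a * r * (int b * fst (block_stats a b) - snd (block_stats a b)) +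
        int b * q * (snd (block_stats a b) - int a * fst (block_stats a b))))"
    using assms(1) by (simp only: of_int_le_iff chord_check_def)
  then have "real_of_int k * ((real b - real a) * ((10 ^ 8 * q') * (10 ^ 8 * r'))) \<le>
      10 ^ 8 * (real a * (10 ^ 8 * r') * (real b * c - s) + real b * (10 ^ 8 * q') * (s - real a * c))"
    by (simp add: q'_def r'_def c_def s_def)
  then have "real_of_int k * ((real b - real a) * (q' * r')) \<le>
      real a * r' * (real b * c - s) + real b * q' * (s - real a * c)"
    by (simp add: algebra_simps)
  then have "real_of_int k * (real b - real a) \<le>
      (real b * c - s) * (real a / q') + (s - real a * c) * (real b / r')"
    using pos by (simp add: field_simps)
  also have "\<dots> \<le> (real b - real a) * prime_sum B a b"
    unfolding c_def s_def
  proof (rule prime_sum_ge_chord)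
    show "real a / q' \<le> log_quotient B (real a)"
      unfolding log_quotient_def using pos q by (intro divide_left_mono) (simp_all add: q'_def)
    show "real b / r' \<le> log_quotient B (real b)"
      unfolding log_quotient_def using pos r by (intro divide_left_mono) (simp_all add: r'_def)
  qed (use ab in simp_all)
  finally show ?thesis
    using ab by (simp add: mult.commute)
qed

lemma chord_certificate_le_last:
  "chord_certificate \<beta> a q blocks \<Longrightarrow> a \<le> last (a # map fst blocks)"
  by (induction blocks arbitrary: a q) (fastforce split: if_splits)+

lemma prime_sum_ge_of_certificate:
  assumes "chord_certificate \<beta> a q blocks" "0 < a" "2 \<le> ln (real a) - B"
    and "ln (real a) - B \<le> real_of_int q / 10 ^ 8" "B = real_of_int \<beta> / 10 ^ 8"
  shows "real_of_int (\<Sum>(b, e, k)\<leftarrow>blocks. k) \<le> prime_sum B a (last (a # map fst blocks))"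
  using assms(1-4)
proof (induction blocks arbitrary: a q)
  case Nil
  then show ?case by (simp add: prime_sum_def)
next
  case (Cons block blocks)
  obtain b e k where block: "block = (b, e, k)"
    by (cases block)
  let ?c = "last (b # map fst blocks)" and ?r = "log_ceiling e - \<beta>"
  have cert: "a < b" "smooth e = b" "chord_check (int a) (int b) q ?r (block_stats a b) k"
    "chord_certificate \<beta> b ?r blocks"
    using Cons.prems(1) by (simp_all add: block)
  have r: "ln (real b) - B \<le> real_of_int ?r / 10 ^ 8"
    using ln_smooth(2)[of e] cert(2) assms(5) by (simp add: diff_divide_distrib)
  have "ln (real a) \<le> ln (real b)"
    using cert(1) Cons.prems(2) by simp
  then have "2 \<le> ln (real b) - B"
    using Cons.prems(3) by linarith
  then have "real_of_int (\<Sum>(b, e, k)\<leftarrow>blocks. k) \<le> prime_sum B b ?c"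
    using Cons.prems cert r by (intro Cons.IH[of b ?r]) auto
  moreover have "real_of_int k \<le> prime_sum B a b"
    using Cons.prems cert r by (intro chord_check_bound)
  moreover have "prime_sum B a ?c = prime_sum B a b + prime_sum B b ?c"
    using cert by (intro prime_sum_split chord_certificate_le_last[of \<beta> b ?r] less_imp_le)
  ultimately show ?case
    by (simp add: block)
qed

section \<open>Numerical data\<close>

text \<open>
  Number and sum of the primes up to the block ends. The ends are 7-smooth, and their
  spacing grows roughly like the square root of their size, which balances the error of a block
  against the cost of evaluating the sieve at its end.
\<close>

lemma prime_stats_1:
  "stats (primes_upto 24) = (9, 100)"
  "stats (primes_upto 1215) = (198, 109147)"
  "stats (primes_upto 3645) = (510, 860821)"
  "stats (primes_upto 7168) = (916, 3048717)"
  "stats (primes_upto 11907) = (1426, 7891043)"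
  "stats (primes_upto 17640) = (2027, 16747430)"
  "stats (primes_upto 24696) = (2734, 31709687)"
  "stats (primes_upto 32928) = (3528, 54582125)"
  "stats (primes_upto 42525) = (4448, 89294911)"
  "stats (primes_upto 52920) = (5400, 134753011)"
  "stats (primes_upto 65536) = (6542, 202288087)"
  "stats (primes_upto 78732) = (7723, 287437350)"
  "stats (primes_upto 93312) = (9013, 398431598)"
  "stats (primes_upto 109375) = (10397, 538673168)"
  "stats (primes_upto 127008) = (11901, 716434188)"
  "stats (primes_upto 145800) = (13491, 933207096)"
  "stats (primes_upto 165888) = (15167, 1194247708)"
  by (simp_all only: sieve_eval prod.inject cong: if_weak_cong)

lemma prime_stats_2:
  "stats (primes_upto 187500) = (16964, 1511951765)"
  "stats (primes_upto 211680) = (18948, 1908117945)"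
  "stats (primes_upto 235298) = (20856, 2334620939)"
  "stats (primes_upto 262144) = (23000, 2867816043)"
  "stats (primes_upto 288120) = (25070, 3436992665)"
  "stats (primes_upto 317520) = (27399, 4142338524)"
  by (simp_all only: sieve_eval prod.inject cong: if_weak_cong)

lemma prime_stats_3:
  "stats (primes_upto 349920) = (29969, 4999713924)"
  "stats (primes_upto 381024) = (32375, 5878925488)"
  "stats (primes_upto 414720) = (34976, 6913640077)"
  "stats (primes_upto 450000) = (37706, 8093723585)"
  "stats (primes_upto 486000) = (40445, 9375433308)"
  by (simp_all only: sieve_eval prod.inject cong: if_weak_cong)

lemma prime_stats_4:
  "stats (primes_upto 525000) = (43442, 10890168189)"
  "stats (primes_upto 564480) = (46412, 12507957869)"
  "stats (primes_upto 607500) = (49668, 14415966945)"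
  "stats (primes_upto 648270) = (52699, 16318985668)"
  by (simp_all only: sieve_eval prod.inject cong: if_weak_cong)

lemma prime_stats_5:
  "stats (primes_upto 694575) = (56152, 18637666521)"
  "stats (primes_upto 740880) = (59589, 21104446908)"
  "stats (primes_upto 790272) = (63226, 23889235661)"
  by (simp_all only: sieve_eval prod.inject cong: if_weak_cong)

lemma prime_stats_6:
  "stats (primes_upto 840000) = (66890, 26875509719)"
  "stats (primes_upto 893025) = (70774, 30241120179)"
  "stats (primes_upto 945000) = (74561, 33721503230)"
  by (simp_all only: sieve_eval prod.inject cong: if_weak_cong)

lemma prime_stats_7:
  "stats (primes_upto 1000000) = (78498, 37550402023)"
  by (simp_all only: sieve_eval prod.inject cong: if_weak_cong)

lemmas prime_stats = prime_stats_1 prime_stats_2 prime_stats_3 prime_stats_4 prime_stats_5 prime_stats_6 prime_stats_7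

text \<open>
  The point of contact of each tangent is a 7-smooth number close to the mean of the primes in the
  block, where the error of the tangent, about half the second derivative times the variance of the
  primes, is least.
\<close>

definition tangent_blocks :: "(nat \<times> exponents \<times> int) list" where
  "tangent_blocks =
   [(1215, (6, 2, 0, 0), 20672), (3645, (0, 0, 0, 4), 112115), (7168, (3, 3, 2, 0), 291347),
    (11907, (1, 3, 2, 1), 599596), (17640, (2, 1, 2, 2), 1040025), (24696, (4, 3, 0, 2), 1685412),
    (32928, (2, 1, 0, 4), 2489962), (42525, (3, 3, 2, 1), 3671080),
    (52920, (2, 5, 0, 2), 4690642), (65536, (0, 10, 0, 0), 6818199),
    (78732, (1, 1, 1, 4), 8427868), (93312, (12, 1, 0, 1), 10797010),
    (109375, (1, 4, 4, 0), 13428415), (127008, (0, 3, 4, 1), 16773758),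
    (145800, (4, 5, 1, 1), 20183002), (165888, (7, 5, 1, 0), 24007001),
    (187500, (0, 11, 0, 0), 28881517), (211680, (6, 0, 5, 0), 35620136),
    (235298, (8, 0, 3, 1), 37962611), (262144, (10, 5, 0, 0), 47012878),
    (288120, (5, 0, 2, 3), 49744959), (317520, (1, 2, 0, 5), 61129750),
    (349920, (2, 5, 0, 3), 73687909), (381024, (2, 6, 3, 0), 74977668),
    (414720, (2, 4, 2, 2), 87604246), (450000, (2, 2, 1, 4), 99214254),
    (486000, (1, 1, 7, 0), 107044541), (525000, (1, 4, 5, 0), 125697485),
    (564480, (6, 5, 1, 1), 133420351), (607500, (5, 1, 3, 2), 156412565),
    (648270, (9, 0, 2, 2), 155126113), (694575, (8, 1, 3, 1), 187979325),
    (740880, (12, 0, 2, 1), 198912653), (790272, (0, 0, 6, 2), 223390305),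
    (840000, (5, 6, 1, 1), 238358845), (893025, (3, 2, 1, 4), 267329377),
    (945000, (1, 1, 5, 2), 275160011), (1000000, (0, 4, 1, 4), 301365443)]"

text \<open>
  The lower bound is needed at 1.0850, which is much farther from the root than 1.0825; blocks about
  twice as long are fine enough.
\<close>

definition chord_blocks :: "(nat \<times> exponents \<times> int) list" where
  "chord_blocks =
   [(3645, (0, 6, 1, 0), 123111), (11907, (0, 5, 0, 2), 881304), (24696, (3, 2, 0, 3), 2714787),
    (42525, (0, 5, 2, 1), 6148742), (65536, (16, 0, 0, 0), 11495547),
    (93312, (7, 6, 0, 0), 19212101), (127008, (5, 4, 0, 2), 30188825),
    (165888, (11, 4, 0, 0), 44178055), (211680, (5, 3, 1, 2), 64489752),
    (262144, (18, 0, 0, 0), 84967796), (317520, (4, 4, 1, 2), 110871580),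
    (381024, (5, 5, 0, 2), 148664601), (450000, (4, 2, 5, 0), 186823938),
    (525000, (3, 1, 5, 1), 232754511), (607500, (2, 5, 4, 0), 289852749),
    (694575, (0, 4, 2, 3), 343135962), (790272, (8, 2, 0, 3), 422343474),
    (893025, (0, 6, 2, 2), 505741507), (1000000, (6, 0, 6, 0), 576593236)]"

lemma tangent_certificate_tangent_blocks: "tangent_certificate 108250000 24 tangent_blocks"
  unfolding tangent_blocks_def by (simp add: tangent_check_def block_stats_def prime_stats)

lemma chord_certificate_chord_blocks:
  "chord_certificate 108500000 24 (log_ceiling (3, 1, 0, 0) - 108500000) chord_blocks"
  unfolding chord_blocks_def by (simp add: chord_check_def block_stats_def prime_stats)

lemma sum_tangent_blocks: "(\<Sum>(b, e, k)\<leftarrow>tangent_blocks. k) = 3081069046"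
  by (simp add: tangent_blocks_def)

lemma sum_chord_blocks: "(\<Sum>(b, e, k)\<leftarrow>chord_blocks. k) = 3081181578"
  by (simp add: chord_blocks_def)

section \<open>The mean as a function of B\<close>

lemma prime_pi_of_nat: "prime_pi (real n) = card (primes_upto n)"
  by (simp add: prime_pi_def primes_upto_def)

lemma primes_upto_Suc:
  "primes_upto (Suc n) = (if prime (Suc n) then insert (Suc n) (primes_upto n) else primes_upto n)"
  by (auto simp: primes_upto_def le_Suc_eq)

text \<open>
  Along the primes the prime counting function takes the values \<open>1, 2, 3, \<dots>\<close>.
\<close>

lemma sum_card_primes_upto:
  "2 * (\<Sum>p\<in>primes_upto n. card (primes_upto p)) = card (primes_upto n) * (card (primes_upto n) + 1)"
proof (induction n)
  case 0
  have "primes_upto 0 = {}"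
    by (auto simp: primes_upto_def)
  then show ?case by simp
next
  case (Suc n)
  have "Suc n \<notin> primes_upto n"
    by (simp add: primes_upto_def)
  then show ?case
    using Suc by (cases "prime (Suc n)") (simp_all add: primes_upto_Suc[of n])
qed

lemma primes_upto_2: "primes_upto 2 = {2}"
  by (auto simp: primes_upto_def dest: prime_ge_2_nat)

lemma sample_primes_eq: "sample_primes = primes_upto (10 ^ 6) - primes_upto 2"
  by (auto simp: sample_primes_def primes_upto_2) (auto simp: primes_upto_def dest: prime_ge_2_nat)

lemma card_primes_upto_million: "card (primes_upto (10 ^ 6)) = 78498"
  using prime_stats by (simp add: stats_def)

text \<open>
  With \<open>N = 78498\<close> primes up to \<open>10 ^ 6\<close>, the constant is \<open>(N * (N + 1) div 2 - 1) + (N - 1)\<close>: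
  the sum of \<open>2, \<dots>, N\<close>, and a 1 for each of the \<open>N - 1\<close> odd primes.
\<close>

lemma sum_E_err:
  "(\<Sum>p\<in>sample_primes. E_err (real p) B) = prime_sum B 2 (10 ^ 6) - 3081085747"
proof -
  let ?P = "primes_upto (10 ^ 6)"
  have two: "primes_upto 2 \<subseteq> ?P"
    by (rule primes_upto_mono) simp
  have card: "card sample_primes = 78497"
    using card_Diff_subset[OF _ two] card_primes_upto_million
    by (simp add: sample_primes_eq primes_upto_2)
  have "(\<Sum>p\<in>?P. card (primes_upto p)) =
      (\<Sum>p\<in>sample_primes. card (primes_upto p)) + (\<Sum>p\<in>primes_upto 2. card (primes_upto p))"
    unfolding sample_primes_eq using two by (intro sum.subset_diff) simp_all
  then have "(\<Sum>p\<in>sample_primes. card (primes_upto p)) = 3081007250"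
    using sum_card_primes_upto[of "10 ^ 6"] card_primes_upto_million by (simp add: primes_upto_2)
  then have "(\<Sum>p\<in>sample_primes. real (card (primes_upto p))) = 3081007250"
    by (simp flip: of_nat_sum)
  then show ?thesis
    using card unfolding prime_sum_def sample_primes_eq[symmetric]
    by (simp add: E_err_def prime_pi_of_nat log_quotient_def sum_subtractf)
qed

lemma mean_E_eq_0_iff: "mean_E B = 0 \<longleftrightarrow> prime_sum B 2 (10 ^ 6) = 3081085747"
proof -
  have "3 \<in> sample_primes" "finite sample_primes"
    by (simp add: sample_primes_def) (simp add: sample_primes_eq)
  then have "card sample_primes \<noteq> 0"
    by auto
  then show ?thesis
    by (simp add: mean_E_def sum_E_err)
qed

lemma ln_sample_prime:
  assumes "p \<in> primes_upto n - primes_upto 2"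
  shows "ln 3 \<le> ln (real p)"
  using assms by (auto simp: primes_upto_def)

lemma prime_sum_strict_mono:
  assumes "B < C" "C < ln 3" "3 \<le> n"
  shows "prime_sum B 2 n < prime_sum C 2 n"
  unfolding prime_sum_def
proof (rule sum_strict_mono)
  have "3 \<in> primes_upto n - primes_upto 2"
    using assms(3) by (simp add: primes_upto_def)
  then show "primes_upto n - primes_upto 2 \<noteq> {}"
    by blast
  fix p assume "p \<in> primes_upto n - primes_upto 2"
  then have "ln 3 \<le> ln (real p)" "0 < real p"
    by (rule ln_sample_prime) (use \<open>p \<in> _\<close> in \<open>auto simp: primes_upto_def prime_gt_0_nat\<close>)
  then have "0 < real p" "0 < ln (real p) - B" "0 < ln (real p) - C"
    using assms by linarith+
  then show "log_quotient B (real p) < log_quotient C (real p)"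
    using assms(1) unfolding log_quotient_def by (intro divide_strict_left_mono mult_pos_pos) auto
qed simp

lemma continuous_on_prime_sum:
  assumes "C < ln 3"
  shows "continuous_on {A..C} (\<lambda>B. prime_sum B 2 n)"
  unfolding prime_sum_def log_quotient_def
proof (intro continuous_intros ballI)
  fix p B assume "p \<in> primes_upto n - primes_upto 2" "B \<in> {A..C}"
  then show "ln (real p) - B \<noteq> 0"
    using ln_sample_prime[of p n] assms by auto
qed

section \<open>The root lies between 1.0825 and 1.0850\<close>

lemma ln_24: "ln (real 24) - B \<le> real_of_int (log_ceiling (3, 1, 0, 0)) / 10 ^ 8 - B"
  "real_of_int (log_floor (3, 1, 0, 0)) / 10 ^ 8 \<le> ln (real 24)"
  using ln_smooth[of "(3, 1, 0, 0)"] by simp_all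

text \<open>
  The concavity estimates start at 24, since \<open>ln x - B \<ge> 2\<close> fails for the smallest primes. There
  a crude bound is enough: only \<open>p = 3\<close> comes close to the pole at \<open>ln x = B\<close>, and the other
  primes have \<open>ln p - B \<ge> 1 / 2\<close>.
\<close>

lemma head_upper: "prime_sum (108250000 / 10 ^ 8) 2 24 \<le> 400"
proof -
  let ?B = "108250000 / 10 ^ 8 :: real"
  let ?P = "primes_upto 24 - primes_upto 2"
  have stats: "stats (primes_upto 24) = (9, 100)"
    by (rule prime_stats)
  have *: "log_quotient ?B (real p) \<le> 2 * real p + (if p = 3 then 200 else 0)" if "p \<in> ?P" for p
  proof (cases "p = 3")
    case True
    have "3 / (ln 3 - ?B) \<le> 3 / (3 / 200)"
      using ln_small_primes_bounds(3) by (intro divide_left_mono) simp_all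
    then show ?thesis
      using True by (simp add: log_quotient_def)
  next
    case False
    have "prime p" "2 < p" "p \<noteq> 3"
      using that False prime_ge_2_nat[of p] by (auto simp: primes_upto_def)
    then have "5 \<le> p"
      using prime_odd_nat[of p] by (cases "p = 4") auto
    then have "ln 5 \<le> ln (real p)"
      by simp
    then have "1 / 2 \<le> ln (real p) - ?B"
      using ln_small_primes_bounds(5) by simp
    then have "real p / (ln (real p) - ?B) \<le> real p / (1 / 2)"
      by (intro divide_left_mono) simp_all
    then show ?thesis
      using False by (simp add: log_quotient_def)
  qed
  have "3 \<in> ?P"
    by (simp add: primes_upto_def)
  have "prime_sum ?B 2 24 \<le> (\<Sum>p\<in>?P. 2 * real p + (if p = 3 then 200 else 0))"
    unfolding prime_sum_def by (intro sum_mono *)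
  also have "\<dots> = 2 * (\<Sum>p\<in>?P. real p) + 200"
    using \<open>3 \<in> ?P\<close> by (simp add: sum.distrib sum_distrib_left)
  also have "(\<Sum>p\<in>?P. real p) = 98"
    using block_stats_eq(2)[of 2 24] stats by (simp add: block_stats_def primes_upto_2) (simp add: stats_def)
  finally show ?thesis
    by simp
qed

lemma upper_value: "prime_sum (108250000 / 10 ^ 8) 2 (10 ^ 6) < 3081085747"
proof -
  have "prime_sum (108250000 / 10 ^ 8) 24 (last (24 # map fst tangent_blocks)) \<le> 3081069046"
    using prime_sum_le_of_certificate[OF tangent_certificate_tangent_blocks, of "108250000 / 10 ^ 8"] ln_24(2)
    by (simp add: sum_tangent_blocks)
  moreover have "last (24 # map fst tangent_blocks) = 10 ^ 6"
    by (simp add: tangent_blocks_def)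
  moreover have "prime_sum (108250000 / 10 ^ 8) 2 (10 ^ 6) =
      prime_sum (108250000 / 10 ^ 8) 2 24 + prime_sum (108250000 / 10 ^ 8) 24 (10 ^ 6)"
    by (rule prime_sum_split) simp_all
  ultimately show ?thesis
    using head_upper by simp
qed

lemma lower_value: "3081085747 < prime_sum (108500000 / 10 ^ 8) 2 (10 ^ 6)"
proof -
  have "3081181578 \<le> prime_sum (108500000 / 10 ^ 8) 24 (last (24 # map fst chord_blocks))"
    using prime_sum_ge_of_certificate[OF chord_certificate_chord_blocks, of "108500000 / 10 ^ 8"]
      ln_24 by (simp add: sum_chord_blocks)
  moreover have "last (24 # map fst chord_blocks) = 10 ^ 6"
    by (simp add: chord_blocks_def)
  moreover have "prime_sum (108500000 / 10 ^ 8) 2 (10 ^ 6) =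
      prime_sum (108500000 / 10 ^ 8) 2 24 + prime_sum (108500000 / 10 ^ 8) 24 (10 ^ 6)"
    by (rule prime_sum_split) simp_all
  moreover have "0 \<le> prime_sum (108500000 / 10 ^ 8) 2 24"
    unfolding prime_sum_def log_quotient_def
  proof (intro sum_nonneg divide_nonneg_nonneg)
    fix p assume "p \<in> primes_upto 24 - primes_upto 2"
    then have "ln 3 \<le> ln (real p)"
      by (rule ln_sample_prime)
    then show "0 \<le> ln (real p) - 108500000 / 10 ^ 8"
      using ln_small_primes_bounds(3) by simp
  qed simp
  ultimately show ?thesis
    by simp
qed

theorem proposition2p1:
  shows "(\<exists>!B\<^sub>0::real. B\<^sub>0 < ln 3 \<and> mean_E B\<^sub>0 = 0) \<and>
    (\<forall>B\<^sub>0::real. B\<^sub>0 < ln 3 \<and> mean_E B\<^sub>0 = 0 \<longrightarrow> 1.0825 \<le> B\<^sub>0 \<and> B\<^sub>0 \<le> 1.0850)"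
proof -
  have ln3: "1.0850 < ln (3::real)"
    using ln_small_primes_bounds(3) by simp
  have lo: "prime_sum 1.0825 2 (10 ^ 6) < 3081085747" and hi: "3081085747 < prime_sum 1.0850 2 (10 ^ 6)"
    using upper_value lower_value by simp_all
  obtain B where B: "1.0825 \<le> B" "B \<le> 1.0850" "prime_sum B 2 (10 ^ 6) = 3081085747"
    using IVT'[of "\<lambda>B. prime_sum B 2 (10 ^ 6)" "1.0825" 3081085747 "1.0850"] lo hi
      continuous_on_prime_sum[OF ln3, of "1.0825" "10 ^ 6"] by auto
  have unique: "C = B" if "C < ln 3" "mean_E C = 0" for C
  proof (rule ccontr)
    assume "C \<noteq> B"
    then consider "C < B" | "B < C"
      by linarith
    then show False
      using prime_sum_strict_mono[of C B "10 ^ 6"] prime_sum_strict_mono[of B C "10 ^ 6"] that B ln3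
      by cases (auto simp: mean_E_eq_0_iff)
  qed
  have "B < ln 3 \<and> mean_E B = 0"
    using B ln3 by (simp add: mean_E_eq_0_iff)
  then show ?thesis
    using unique B by blast
qed

end
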